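(* If $G$ is a connected graph of maximum degree $d\geq 3$, then either $G\cong K_{d+1}$ or $G$ is weakly $(d-1)$-degenerate.
   Context: All graphs are finite and simple; $\mathbb{N}=\{0,1,2,\ldots\}$. $K_{d+1}$ is the complete graph on $d+1$ vertices. Weak degeneracy: let $G$ be a graph and $f\colon V(G)\to\mathbb{N}$. For a vertex $u$, the operation $\mathrm{Delete}(G,f,u)$ outputs $G'=G-u$ and $f'\colon V(G')\to\mathbb{Z}$ with $f'(v)=f(v)-1$ if $uv\in E(G)$ and $f'(v)=f(v)$ otherwise; its application is legal if $f'(v)\geq 0$ for all $v\in V(G')$. For adjacent vertices $u,w$, the operation $\mathrm{DelSave}(G,f,u,w)$ outputs $G'=G-u$ and $f'\colon V(G')\to\mathbb{Z}$ with $f'(v)=f(v)-1$ if $uv\in E(G)$ and $v\neq w$, and $f'(v)=f(v)$ otherwise; its application is legal if $f(u)>f(w)$ and $f'$ is non-negative. $G$ is weakly $f$-degenerate if all vertices of $G$ can be removed by a sequence of legal applications of Delete and DelSave, starting with $(G,f)$. For $d\in\mathbb{N}$, $G$ is weakly $d$-degenerate if it is weakly degenerate with respect to the constant $d$ function. *)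

theory Defs
  imports "Graph_Theory.Graph_Theory"
begin

text \<open>
  A finite simple graph is a term satisfying the locale predicate \<^const>\<open>graph\<close>: a finite symmetric
  digraph without loops or parallel arcs. An edge \<open>uv\<close> is represented by the two arcs \<open>(u, v)\<close> and
  \<open>(v, u)\<close>, so adjacency is \<open>u \<rightarrow>\<^bsub>G\<^esub> v\<close> and the degree of a vertex is its out-degree.
\<close>

definition max_degree :: "('a, 'b) pre_digraph \<Rightarrow> nat" where
  "max_degree G = Max (out_degree G ` verts G)"

definition complete_graph :: "nat \<Rightarrow> nat pair_pre_digraph" where
  "complete_graph n = \<lparr> pverts = {..<n}, parcs = {(u, v). u < n \<and> v < n \<and> u \<noteq> v} \<rparr>"

lemma complete_graph_is_complete: "K\<^bsub>n\<^esub> (with_proj (complete_graph n))"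
  by (auto simp: complete_digraph_pair_def complete_graph_def)

text \<open>
  States are pairs of a graph and an integer-valued function on the whole vertex type; only its
  values on the vertices of the graph matter.
\<close>

definition del_op ::
  "('a, 'b) pre_digraph \<Rightarrow> ('a \<Rightarrow> int) \<Rightarrow> 'a \<Rightarrow> ('a, 'b) pre_digraph \<times> ('a \<Rightarrow> int)" where
  "del_op G f u =
    (pre_digraph.del_vert G u, \<lambda>v. if u \<rightarrow>\<^bsub>G\<^esub> v then f v - 1 else f v)"

definition delsave_op ::
  "('a, 'b) pre_digraph \<Rightarrow> ('a \<Rightarrow> int) \<Rightarrow> 'a \<Rightarrow> 'a \<Rightarrow> ('a, 'b) pre_digraph \<times> ('a \<Rightarrow> int)" where
  "delsave_op G f u w =
    (pre_digraph.del_vert G u, \<lambda>v. if u \<rightarrow>\<^bsub>G\<^esub> v \<and> v \<noteq> w then f v - 1 else f v)"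

definition nonneg_state :: "('a, 'b) pre_digraph \<times> ('a \<Rightarrow> int) \<Rightarrow> bool" where
  "nonneg_state S \<longleftrightarrow> (\<forall>v \<in> verts (fst S). snd S v \<ge> 0)"

inductive legal_step ::
  "('a, 'b) pre_digraph \<times> ('a \<Rightarrow> int) \<Rightarrow> ('a, 'b) pre_digraph \<times> ('a \<Rightarrow> int) \<Rightarrow> bool" where
  del: "u \<in> verts G \<Longrightarrow> nonneg_state (del_op G f u) \<Longrightarrow> legal_step (G, f) (del_op G f u)"
| delsave: "u \<in> verts G \<Longrightarrow> w \<in> verts G \<Longrightarrow> u \<rightarrow>\<^bsub>G\<^esub> w \<Longrightarrow> f u > f w \<Longrightarrow>
    nonneg_state (delsave_op G f u w) \<Longrightarrow> legal_step (G, f) (delsave_op G f u w)"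

definition weakly_f_degenerate :: "('a, 'b) pre_digraph \<Rightarrow> ('a \<Rightarrow> nat) \<Rightarrow> bool" where
  "weakly_f_degenerate G f \<longleftrightarrow>
    (\<exists>H g. legal_step\<^sup>*\<^sup>* (G, \<lambda>v. int (f v)) (H, g) \<and> verts H = {})"

definition weakly_degenerate :: "nat \<Rightarrow> ('a, 'b) pre_digraph \<Rightarrow> bool" where
  "weakly_degenerate d G \<longleftrightarrow> weakly_f_degenerate G (\<lambda>_. d)"

end

theory Submission
  imports Defs
begin

text \<open>
  Call \<open>f v - deg v\<close> the surplus of \<open>v\<close>, where \<open>deg\<close> is the degree in the graph that remains. A
  deletion changes no surplus and a deletion that saves \<open>w\<close> raises that of \<open>w\<close> by one. If the graph
  is connected, all surpluses are at least \<open>-1\<close> and some root has a surplus of at least \<open>0\<close>, then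
  the vertices can be deleted one by one, always a non-cut vertex and the root last
  (\<open>removable_if_surplus\<close>). With the constant budget \<open>d - 1\<close> a vertex of degree below \<open>d\<close> is such a
  root, so it remains to treat \<open>d\<close>-regular graphs, where every surplus is \<open>-1\<close> and a single
  legal save is wanted.

  Such a save is available inside a connected induced subgraph \<open>H\<close> that has an edge \<open>uw\<close> with
  \<open>deg u > deg w\<close> in \<open>H\<close> and with \<open>H - u\<close> connected: peel the graph down to \<open>H\<close>, where the budget
  is now \<open>deg - 1\<close>, delete \<open>u\<close> and save \<open>w\<close>, then finish with \<open>w\<close> as the root
  (\<open>removable_if_breakable\<close>). The claim has become purely graph theoretic: a connected \<open>d\<close>-regular
  graph with \<open>d \<ge> 3\<close> that has no such \<open>H, u, w\<close> is complete.

  Take a longest path and cut it at the last neighbour of its first vertex. This gives a cycle \<open>C\<close>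
  that contains all neighbours of one of its vertices. A graph with a Hamiltonian cycle has no cut
  vertex, so the subgraph induced by \<open>C\<close> must be regular, hence \<open>d\<close>-regular, and by connectedness
  \<open>C\<close> is a Hamiltonian cycle of the whole graph. If \<open>a, b, c\<close> are consecutive on \<open>C\<close> then \<open>a\<close> and
  \<open>c\<close> are adjacent, for otherwise \<open>G - a\<close> with the edge \<open>cb\<close> would do (\<open>cycle_chord_or_breakable\<close>).
  These chords bridge every gap in \<open>C\<close>, so removing any two vertices leaves the graph connected. If some
  vertex \<open>a\<close> had a non-neighbour, an edge \<open>uw\<close> of \<open>G - a\<close> with \<open>w\<close> but not \<open>u\<close> adjacent to \<open>a\<close>
  would therefore do as well (\<open>hamiltonian_complete_or_breakable\<close>).
\<close>

section \<open>Connected vertex sets and induced degrees\<close>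

locale adjacency =
  fixes E :: "'a \<Rightarrow> 'a \<Rightarrow> bool"
  assumes adj_sym: "E u v \<Longrightarrow> E v u"
    and adj_irrefl: "\<not> E v v"
begin

text \<open>
  Connectedness is expressed by cuts, every proper nonempty part being left by an edge, because it is
  mostly used to find an edge between vertices that differ in some property.
\<close>

definition conn :: "'a set \<Rightarrow> bool" where
  "conn S \<longleftrightarrow> (\<forall>A \<subseteq> S. A \<noteq> {} \<longrightarrow> A \<noteq> S \<longrightarrow> (\<exists>x \<in> A. \<exists>y \<in> S - A. E x y))"

definition deg :: "'a set \<Rightarrow> 'a \<Rightarrow> nat" where
  "deg S v = card {w \<in> S. E v w}"

lemma connE:
  assumes "conn S" "A \<subseteq> S" "A \<noteq> {}" "A \<noteq> S"
  obtains x y where "x \<in> A" "y \<in> S" "y \<notin> A" "E x y"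
  using assms unfolding conn_def by blast

lemma conn_singleton: "conn {v}"
  unfolding conn_def by blast

lemma conn_empty: "conn {}"
  unfolding conn_def by blast

lemma conn_Un:
  assumes "conn A" "conn B" "a \<in> A" "b \<in> B" "E a b"
  shows "conn (A \<union> B)"
  unfolding conn_def
proof (intro allI impI)
  fix X assume X: "X \<subseteq> A \<union> B" "X \<noteq> {}" "X \<noteq> A \<union> B"
  consider "X \<inter> A \<noteq> {}" "X \<inter> A \<noteq> A" | "X \<inter> B \<noteq> {}" "X \<inter> B \<noteq> B"
    | "A \<subseteq> X" "X \<inter> B = {}" | "B \<subseteq> X" "X \<inter> A = {}"
    using X by blast
  then show "\<exists>x \<in> X. \<exists>y \<in> A \<union> B - X. E x y"
  proof cases
    case 1
    then obtain x y where "x \<in> X \<inter> A" "y \<in> A" "y \<notin> X \<inter> A" "E x y"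
      using connE[OF assms(1), of "X \<inter> A"] by blast
    then show ?thesis by blast
  next
    case 2
    then obtain x y where "x \<in> X \<inter> B" "y \<in> B" "y \<notin> X \<inter> B" "E x y"
      using connE[OF assms(2), of "X \<inter> B"] by blast
    then show ?thesis by blast
  next
    case 3
    then show ?thesis using assms by blast
  next
    case 4
    then show ?thesis using assms adj_sym by blast
  qed
qed

lemma conn_insert: "conn T \<Longrightarrow> x \<in> T \<Longrightarrow> E x y \<Longrightarrow> conn (insert y T)"
  using conn_Un[of T "{y}" x y] conn_singleton by simp

lemma conn_successively: "successively E xs \<Longrightarrow> conn (set xs)"
proof (induction xs)
  case Nil
  then show ?case by (simp add: conn_empty)
next
  case (Cons x xs)
  show ?case
  proof (cases "xs = []")
    case True
    then show ?thesis by (simp add: conn_singleton)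
  next
    case False
    then have "E x (hd xs)" "successively E xs" using Cons.prems by (auto simp: successively_Cons)
    then show ?thesis using Cons.IH False conn_insert[of "set xs" "hd xs" x] adj_sym by simp
  qed
qed

text \<open>
  A largest connected proper subset containing \<open>T\<close> misses only one vertex, since otherwise an edge
  leaving it would produce a larger one.
\<close>

lemma exists_removable_vertex:
  assumes "finite S" "conn S" "conn T" "T \<noteq> {}" "T \<subset> S"
  obtains u where "u \<in> S - T" "conn (S - {u})"
proof -
  let ?P = "\<lambda>T'. T \<subseteq> T' \<and> T' \<subset> S \<and> conn T'"
  have "\<forall>T'. ?P T' \<longrightarrow> card T' < card S" using assms(1) by (auto intro: psubset_card_mono)
  moreover have "?P T" using assms(3,5) by blast
  ultimately have "\<exists>M. ?P M \<and> (\<forall>T'. ?P T' \<longrightarrow> card T' \<le> card M)"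
    by (intro ex_has_greatest_nat[of ?P T card "card S"])
  then obtain M where M: "?P M" and max: "\<And>T'. ?P T' \<Longrightarrow> card T' \<le> card M"
    by metis
  obtain x y where xy: "x \<in> M" "y \<in> S" "y \<notin> M" "E x y"
    using connE[OF assms(2), of M] M assms(4) by blast
  have "conn (insert y M)" using M xy conn_insert by blast
  moreover have "finite M" using M assms(1) finite_subset by blast
  then have "card (insert y M) > card M" using xy by simp
  ultimately have "insert y M = S" using max[of "insert y M"] M xy by force
  then have "S - {y} = M" using xy by blast
  then show ?thesis using that[of y] M xy by blast
qed

lemma conn_has_neighbour:
  assumes "conn S" "v \<in> S" "w \<in> S" "v \<noteq> w"
  obtains x where "x \<in> S" "E v x"
  using connE[OF assms(1), of "{v}"] assms by blast

lemma deg_pos: "finite S \<Longrightarrow> x \<in> S \<Longrightarrow> E v x \<Longrightarrow> deg S v \<ge> 1"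
  unfolding deg_def by (auto simp: Suc_le_eq card_gt_0_iff)

lemma conn_deg_pos:
  assumes "finite S" "conn S" "v \<in> S" "w \<in> S" "v \<noteq> w"
  shows "deg S v \<ge> 1"
  using conn_has_neighbour[OF assms(2-)] deg_pos assms(1) by metis

lemma deg_mono: "finite S \<Longrightarrow> T \<subseteq> S \<Longrightarrow> deg T v \<le> deg S v"
  unfolding deg_def by (intro card_mono) auto

lemma deg_insert:
  assumes "finite S" "u \<notin> S"
  shows "deg (insert u S) v = deg S v + (if E v u then 1 else 0)"
proof -
  have "{w \<in> insert u S. E v w} = (if E v u then insert u {w \<in> S. E v w} else {w \<in> S. E v w})"
    by auto
  then show ?thesis using assms by (simp add: deg_def)
qed

lemma deg_Diff_singleton:
  assumes "finite S" "u \<in> S"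
  shows "deg S v = deg (S - {u}) v + (if E u v then 1 else 0)"
  using deg_insert[of "S - {u}" u v] assms adj_sym by (auto simp: insert_absorb)

lemma deg_eqD:
  assumes "finite S" "T \<subseteq> S" "deg T v = deg S v" "w \<in> S" "E v w"
  shows "w \<in> T"
proof -
  have "{w \<in> T. E v w} = {w \<in> S. E v w}"
    using assms(1-3) by (intro card_subset_eq) (auto simp: deg_def)
  then show ?thesis using assms(4,5) by auto
qed

section \<open>The deletion game on vertex sets\<close>

text \<open>
  The game is played on subsets of a fixed vertex set with a fixed adjacency relation, so that
  induced subgraphs are just sets and no graph has to be rebuilt after a deletion. Naming the new
  budget \<open>g\<close> by an equation lets the rules be applied without unifying lambda terms.
\<close>

inductive removable :: "'a set \<Rightarrow> ('a \<Rightarrow> int) \<Rightarrow> bool" where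
  empty: "removable {} f"
| del: "u \<in> S \<Longrightarrow> g = (\<lambda>v. if E u v then f v - 1 else f v) \<Longrightarrow> \<forall>v \<in> S - {u}. g v \<ge> 0 \<Longrightarrow>
    removable (S - {u}) g \<Longrightarrow> removable S f"
| delsave: "u \<in> S \<Longrightarrow> w \<in> S \<Longrightarrow> E u w \<Longrightarrow> f u > f w \<Longrightarrow>
    g = (\<lambda>v. if E u v \<and> v \<noteq> w then f v - 1 else f v) \<Longrightarrow> \<forall>v \<in> S - {u}. g v \<ge> 0 \<Longrightarrow>
    removable (S - {u}) g \<Longrightarrow> removable S f"

text \<open>
  Deleting non-cut vertices outside \<open>T\<close> keeps every surplus \<open>f v - deg S v\<close>, so the budget that
  remains on \<open>T\<close> is determined by the surpluses. All deletions are legal: a vertex outside \<open>T\<close> still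
  has a neighbour, which makes up for a surplus of \<open>-1\<close>, and on \<open>T\<close> the budget only decreases
  towards its final value, which is non-negative.
\<close>

lemma removable_by_peeling:
  assumes "finite S" "conn S" "conn T" "T \<noteq> {}" "T \<subseteq> S"
    and "\<forall>v \<in> S. f v \<ge> int (deg S v) - 1"
    and "\<forall>v \<in> T. f v - deg S v + deg T v \<ge> 0"
    and "\<And>g. \<forall>v \<in> T. g v = f v - deg S v + deg T v \<Longrightarrow> removable T g"
  shows "removable S f"
  using assms
proof (induction "card S" arbitrary: S f rule: less_induct)
  case less
  show ?case
  proof (cases "T = S")
    case True
    then show ?thesis using less.prems(8) by simp
  next
    case False
    then obtain u where u: "u \<in> S - T" "conn (S - {u})"
      using exists_removable_vertex less.prems by blast
    let ?S = "S - {u}"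
    define g where "g = (\<lambda>v. if E u v then f v - 1 else f v)"
    have fin: "finite ?S" using less.prems(1) by simp
    have TS: "T \<subseteq> ?S" using u less.prems by blast
    \<comment> \<open>deletions preserve the difference between budget and remaining degree\<close>
    have surplus: "g v - deg ?S v = f v - deg S v" for v
      using deg_Diff_singleton[of S u v] u less.prems(1) by (simp add: g_def)
    have low: "g v \<ge> int (deg ?S v) - 1" if "v \<in> ?S" for v
      using surplus[of v] less.prems(6) that by force
    have "g v \<ge> 0" if v: "v \<in> ?S" for v
    proof (cases "v \<in> T")
      case True
      then have "f v - deg S v + deg T v \<ge> 0" using less.prems(7) by blast
      then show ?thesis using surplus[of v] deg_mono[OF fin TS, of v] by linarith
    next
      case False
      then obtain t where "t \<in> ?S" "t \<noteq> v" using less.prems(4) TS by blast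
      then have "deg ?S v \<ge> 1" using conn_deg_pos[OF fin u(2) v] by blast
      then show ?thesis using low[OF v] by linarith
    qed
    moreover have "removable ?S g"
    proof (rule less.hyps)
      show "card ?S < card S" using u less.prems(1) by (intro psubset_card_mono) auto
      show "removable T h" if "\<forall>v \<in> T. h v = g v - deg ?S v + deg T v" for h
        using that by (intro less.prems(8)) (simp add: surplus)
    qed (use fin u TS less.prems low surplus in auto)
    ultimately show ?thesis using removable.del[OF _ g_def] u by blast
  qed
qed

lemma removable_if_surplus:
  assumes "finite S" "conn S" "r \<in> S"
    and "\<forall>v \<in> S. f v \<ge> int (deg S v) - 1" "f r \<ge> int (deg S r)"
  shows "removable S f"
proof (rule removable_by_peeling[where T = "{r}"])
  show "removable {r} g" for g
    by (rule removable.del[of r _ "\<lambda>v. if E r v then g v - 1 else g v"]) (auto intro: removable.empty)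
qed (use assms conn_singleton in \<open>auto\<close>)

text \<open>
  The configuration that allows a save once the graph has been peeled down to \<open>H\<close> and the budget has
  become \<open>deg H - 1\<close>: the strict inequality of degrees is the legality condition of the save.
\<close>

definition breakable :: "'a set \<Rightarrow> 'a \<Rightarrow> 'a \<Rightarrow> bool" where
  "breakable H u w \<longleftrightarrow> conn H \<and> u \<in> H \<and> w \<in> H \<and> E u w \<and> deg H u > deg H w \<and> conn (H - {u})"

lemma removable_if_breakable:
  assumes "finite S" "conn S" "H \<subseteq> S" "breakable H u w"
    and f: "\<forall>v \<in> S. f v = int (deg S v) - 1"
  shows "removable S f"
proof (rule removable_by_peeling[where T = H])
  have H: "conn H" "u \<in> H" "w \<in> H" "E u w" "deg H u > deg H w" "conn (H - {u})"
    using assms(4) by (auto simp: breakable_def)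
  have fin: "finite H" using assms(1,3) finite_subset by blast
  have uw: "u \<noteq> w" using H adj_irrefl by blast
  show "conn H" "H \<noteq> {}" using H by auto
  have pos: "deg H v \<ge> 1" if "v \<in> H" for v
    using conn_deg_pos[OF fin H(1) that] H(2,3) uw by metis
  then show "\<forall>v \<in> H. f v - deg S v + deg H v \<ge> 0" using f assms(3) by force
  show "removable H g" if g0: "\<forall>v \<in> H. g v = f v - deg S v + deg H v" for g
  proof -
    have g: "g v = int (deg H v) - 1" if "v \<in> H" for v using g0 f assms(3) that by auto
    define h where "h = (\<lambda>v. if E u v \<and> v \<noteq> w then g v - 1 else g v)"
    let ?H = "H - {u}"
    have fin': "finite ?H" using fin by simp
    have low: "h v \<ge> int (deg ?H v) - 1" if "v \<in> ?H" for v
      using deg_Diff_singleton[OF fin H(2), of v] g[of v] that by (simp add: h_def)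
    \<comment> \<open>the saved vertex loses a neighbour but no budget and so becomes a root\<close>
    have root: "h w = int (deg ?H w)"
      using deg_Diff_singleton[OF fin H(2), of w] g[of w] H by (simp add: h_def)
    have "h v \<ge> 0" if "v \<in> ?H" for v
    proof (cases "v = w")
      case False
      then have "deg ?H v \<ge> 1" using conn_deg_pos[OF fin' H(6) that] H(3) uw by auto
      then show ?thesis using low[OF that] by linarith
    qed (use root in simp)
    moreover have "removable ?H h"
      using removable_if_surplus[OF fin' H(6), of w h] low root H uw by auto
    moreover have "g u > g w" using g H by simp
    ultimately show ?thesis using removable.delsave[OF H(2,3,4) _ h_def] by blast
  qed
qed (use assms in auto)

section \<open>Cycles\<close>

definition cyc :: "'a list \<Rightarrow> bool" where
  "cyc xs \<longleftrightarrow> xs \<noteq> [] \<and> distinct xs \<and> successively E xs \<and> E (last xs) (hd xs)"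

lemma cyc_rotate: "cyc (xs @ ys) \<Longrightarrow> cyc (ys @ xs)"
  by (cases "xs = []"; cases "ys = []") (auto simp: cyc_def successively_append_iff)

lemma cyc_conn: "cyc xs \<Longrightarrow> conn (set xs)"
  by (simp add: cyc_def conn_successively)

lemma cyc_Cons_conn: "cyc (x # xs) \<Longrightarrow> conn (set xs)"
  by (simp add: cyc_def conn_successively successively_Cons split: if_splits)
     (auto simp: conn_empty)

lemma cyc_starting_at:
  assumes "cyc xs" "x \<in> set xs"
  obtains ys where "cyc (x # ys)" "set (x # ys) = set xs"
proof -
  obtain ps qs where "xs = ps @ x # qs" using assms(2) split_list by metis
  then show ?thesis using that[of "qs @ ps"] cyc_rotate[of ps "x # qs"] assms(1) by auto
qed

text \<open>
  The rest of the cycle is a path.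
\<close>

lemma cyc_conn_delete:
  assumes "cyc xs" "x \<in> set xs"
  shows "conn (set xs - {x})"
proof -
  obtain ys where ys: "cyc (x # ys)" "set (x # ys) = set xs" using cyc_starting_at assms by metis
  then have "set xs - {x} = set ys" by (auto simp: cyc_def)
  then show ?thesis using cyc_Cons_conn ys(1) by metis
qed

text \<open>
  A connected graph that is not regular has an edge whose ends have different degrees, and on a cycle
  either end can be removed without disconnecting the rest.
\<close>

lemma irregular_cycle_breakable:
  assumes "cyc xs" "v \<in> set xs" "v' \<in> set xs" "deg (set xs) v \<noteq> deg (set xs) v'"
  shows "\<exists>u w. breakable (set xs) u w"
proof -
  let ?C = "set xs"
  let ?A = "{x \<in> ?C. deg ?C x = deg ?C v}"
  have "v' \<notin> ?A" using assms(4) by simp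
  then have A: "?A \<subseteq> ?C" "?A \<noteq> {}" "?A \<noteq> ?C" using assms(2,3) by blast+
  obtain x y where "x \<in> ?A" "y \<in> ?C" "y \<notin> ?A" "E x y"
    by (rule connE[OF cyc_conn[OF assms(1)] A])
  then have xy: "x \<in> ?C" "y \<in> ?C" "deg ?C x \<noteq> deg ?C y" "E x y" "E y x" using adj_sym by auto
  note conn' = cyc_conn[OF assms(1)] cyc_conn_delete[OF assms(1) xy(1)] cyc_conn_delete[OF assms(1) xy(2)]
  show ?thesis
  proof (cases "deg ?C x < deg ?C y")
    case True
    then have "breakable ?C y x" using xy conn' by (simp add: breakable_def)
    then show ?thesis by blast
  next
    case False
    then have "breakable ?C x y" using xy conn' by (simp add: breakable_def)
    then show ?thesis by blast
  qed
qed

text \<open>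
  A longest path cannot be extended at its first vertex, so all neighbours of that vertex lie on it;
  the initial segment up to the last of them closes to a cycle. If the vertices have degree one this
  cycle may be a single edge traversed twice, which \<open>cyc\<close> admits.
\<close>

lemma exists_cycle_with_full_neighbourhood:
  assumes "finite V" "V \<noteq> {}" and deg: "\<forall>v \<in> V. deg V v \<ge> 1"
  obtains xs where "cyc xs" "set xs \<subseteq> V" "\<And>w. w \<in> V \<Longrightarrow> E (hd xs) w \<Longrightarrow> w \<in> set xs"
proof -
  define path where "path xs \<longleftrightarrow> xs \<noteq> [] \<and> distinct xs \<and> successively E xs \<and> set xs \<subseteq> V" for xs
  have bound: "length xs < Suc (card V)" if "path xs" for xs
  proof -
    have "length xs = card (set xs)" using that by (simp add: path_def distinct_card)
    also have "\<dots> \<le> card V" using that by (intro card_mono assms(1)) (simp add: path_def)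
    finally show ?thesis by simp
  qed
  obtain v where "v \<in> V" using assms(2) by blast
  then have "path [v]" by (simp add: path_def)
  then obtain xs where path: "path xs" and max: "\<And>ys. path ys \<Longrightarrow> length ys \<le> length xs"
    using ex_has_greatest_nat[of path "[v]" length "Suc (card V)"] bound by blast
  have xs: "xs \<noteq> []" "distinct xs" "successively E xs" "set xs \<subseteq> V"
    using path by (auto simp: path_def)
  let ?v = "hd xs"
  have nb: "w \<in> set xs" if w: "w \<in> V" "E ?v w" for w
  proof (rule ccontr)
    assume "w \<notin> set xs"
    then have "path (w # xs)" using xs w adj_sym by (simp add: path_def successively_Cons)
    then show False using max[of "w # xs"] by simp
  qed
  let ?I = "{i. i < length xs \<and> E ?v (xs ! i)}"
  have "?v \<in> V" using xs(1,4) by auto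
  then have "card {w \<in> V. E ?v w} \<noteq> 0" using deg unfolding deg_def by fastforce
  then obtain w where "w \<in> V" "E ?v w" by (auto simp: card_eq_0_iff)
  then obtain i where "i < length xs" "E ?v (xs ! i)" using nb by (metis in_set_conv_nth)
  then have "?I \<noteq> {}" by blast
  moreover have fin: "finite ?I" by simp
  ultimately have k: "Max ?I \<in> ?I" by (rule Max_in[rotated])
  define k where "k = Max ?I"
  let ?C = "take (Suc k) xs"
  have k': "k < length xs" "E ?v (xs ! k)" using k by (auto simp: k_def)
  have C: "?C \<noteq> []" "distinct ?C" "set ?C \<subseteq> V" "last ?C = xs ! k" and hd: "hd ?C = ?v"
    using xs k'(1) set_take_subset[of "Suc k" xs]
    by (simp_all del: take_Suc add: take_Suc_conv_app_nth[symmetric] hd_take)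
       (simp_all add: take_Suc_conv_app_nth)
  have "successively E (?C @ drop (Suc k) xs)" using xs(3) by simp
  then have "successively E ?C" unfolding successively_append_iff by blast
  then have "cyc ?C" using C hd adj_sym[OF k'(2)] by (simp add: cyc_def)
  moreover have "w \<in> set ?C" if w: "w \<in> V" "E (hd ?C) w" for w
  proof -
    have w': "E ?v w" using w hd by simp
    obtain i where i: "i < length xs" "xs ! i = w" using nb[OF w(1) w'] by (metis in_set_conv_nth)
    then have "i \<le> k" using w' fin unfolding k_def by (intro Max_ge) auto
    then have "?C ! i = w" "i < length ?C" using i by auto
    then show ?thesis by (metis nth_mem)
  qed
  ultimately show ?thesis using that[of ?C] C(3) by blast
qed

section \<open>Regular graphs\<close>

text \<open>
  On a cycle \<open>C\<close> that contains all neighbours of one of its vertices, this vertex keeps its degree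
  \<open>d\<close>. If \<open>C\<close> misses a vertex, some edge leaves \<open>C\<close>, and its end on \<open>C\<close> has smaller degree within
  \<open>C\<close>.
\<close>

lemma regular_hamiltonian_or_breakable:
  assumes "finite V" "V \<noteq> {}" "conn V" and reg: "\<forall>v \<in> V. deg V v = d" and "d \<ge> 1"
  obtains (breakable) H u w where "H \<subseteq> V" "breakable H u w"
    | (hamiltonian) xs where "cyc xs" "set xs = V"
proof -
  obtain xs where xs: "cyc xs" "set xs \<subseteq> V" "\<And>w. w \<in> V \<Longrightarrow> E (hd xs) w \<Longrightarrow> w \<in> set xs"
    using exists_cycle_with_full_neighbourhood assms by metis
  let ?C = "set xs"
  have hd: "hd xs \<in> ?C" using xs(1) by (simp add: cyc_def)
  show ?thesis
  proof (cases "?C = V")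
    case True
    then show ?thesis using hamiltonian xs(1) by blast
  next
    case False
    moreover have "?C \<noteq> {}" using hd by auto
    ultimately obtain x y where xy: "x \<in> ?C" "y \<in> V" "y \<notin> ?C" "E x y"
      using connE[OF assms(3) xs(2)] by blast
    have "{w \<in> ?C. E (hd xs) w} = {w \<in> V. E (hd xs) w}" using xs(2,3) by blast
    then have "deg ?C (hd xs) = d" using reg hd xs(2) by (auto simp: deg_def)
    moreover have "deg ?C x \<noteq> d"
      using deg_eqD[OF assms(1) xs(2), of x y] xy reg xs(2) by auto
    ultimately show ?thesis using irregular_cycle_breakable[OF xs(1) hd xy(1)] breakable xs(2) by metis
  qed
qed

text \<open>
  Removing \<open>a\<close> costs \<open>b\<close> a neighbour but not \<open>c\<close>. The vertices other than \<open>a\<close>, \<open>b\<close>, \<open>c\<close> form a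
  path, to which \<open>b\<close> is attached by a third neighbour; this is where \<open>d \<ge> 3\<close> enters.
\<close>

lemma cycle_chord_or_breakable:
  assumes "cyc (a # b # c # xs)" "V = set (a # b # c # xs)"
    and reg: "\<forall>v \<in> V. deg V v = d" and "d \<ge> 3" and "\<not> E a c"
  shows "breakable (V - {a}) c b"
proof -
  have fin: "finite V" using assms(2) by simp
  have dist: "distinct (a # b # c # xs)" and suc: "successively E (a # b # c # xs)"
    using assms(1) by (auto simp: cyc_def)
  have adj: "E a b" "E b c" "E c b" using suc adj_sym by auto
  have "\<not> {w \<in> V. E b w} \<subseteq> {a, c}"
  proof
    assume "{w \<in> V. E b w} \<subseteq> {a, c}"
    then have "deg V b \<le> card {a, c}" unfolding deg_def by (intro card_mono) auto
    also have "\<dots> \<le> 2" by (simp add: card_insert_if)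
    finally show False using reg assms(2,4) by simp
  qed
  then obtain w where w: "w \<in> set xs" "E b w" using assms(2) adj_irrefl by auto
  have "conn (set xs)" using suc by (intro conn_successively) (auto simp: successively_Cons conn_empty)
  then have "conn (insert b (set xs))" using w conn_insert adj_sym by metis
  moreover have "V - {a} - {c} = insert b (set xs)" using dist assms(2) by auto
  moreover have "conn (V - {a})"
    using cyc_conn_delete[OF assms(1), of a] assms(2) by simp
  moreover have "deg V b = d" "deg V c = d" using reg assms(2) by auto
  then have "deg (V - {a}) b < deg (V - {a}) c"
    using deg_Diff_singleton[OF fin, of a b] deg_Diff_singleton[OF fin, of a c] assms(2,5) adj
    by simp
  ultimately show ?thesis using adj dist assms(2) by (auto simp: breakable_def)
qed

text \<open>
  If \<open>a\<close> is not adjacent to everything, connectedness of \<open>V - {a}\<close> yields an edge \<open>wu\<close> from a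
  neighbour of \<open>a\<close> to a non-neighbour. Removing \<open>a\<close> then lowers the degree of \<open>w\<close> but not of \<open>u\<close>, and
  removing \<open>u\<close> as well splits the cycle into two paths that a chord joins across \<open>u\<close>.
\<close>

lemma hamiltonian_complete_or_breakable:
  assumes "cyc xs" "set xs = V" and reg: "\<forall>v \<in> V. deg V v = d" and "d \<ge> 3"
    and unbreakable: "\<And>H u w. H \<subseteq> V \<Longrightarrow> \<not> breakable H u w"
    and ab: "a \<in> V" "b \<in> V" "a \<noteq> b"
  shows "E a b"
proof (rule ccontr)
  assume "\<not> E a b"
  have fin: "finite V" using assms(2) by auto
  have chord: "E x z" if "cyc (x # y # z # zs)" "set (x # y # z # zs) = V" for x y z zs
    using cycle_chord_or_breakable[OF that(1) that(2)[symmetric] reg \<open>d \<ge> 3\<close>] unbreakable[of "V - {x}" z y]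
    by blast
  obtain ys where ys: "cyc (a # ys)" "set (a # ys) = V"
    using cyc_starting_at[OF assms(1)] ab(1) assms(2) by metis
  have V': "set ys = V - {a}" using ys by (auto simp: cyc_def)
  have conn': "conn (V - {a})" using cyc_Cons_conn[OF ys(1)] V' by simp
  let ?N = "{x \<in> V. E a x}"
  have "deg V a \<noteq> 0" using reg ab(1) \<open>d \<ge> 3\<close> by simp
  then have "?N \<noteq> {}" unfolding deg_def by (metis card.empty)
  moreover have "?N \<subseteq> V - {a}" using adj_irrefl by blast
  moreover have "?N \<noteq> V - {a}" using \<open>\<not> E a b\<close> ab by blast
  ultimately obtain w u where "w \<in> ?N" "u \<in> V - {a}" "u \<notin> ?N" "E w u"
    using connE[OF conn', of ?N] by blast
  then have wu: "w \<in> V" "E a w" "u \<in> V" "u \<noteq> a" "\<not> E a u" "E w u" by auto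
  have u_ys: "u \<in> set ys" using wu V' by simp
  then obtain ps qs where split: "ys = ps @ u # qs" by (metis split_list)
  have suc: "successively E ps" "successively E qs"
    using ys(1) split by (auto simp: cyc_def successively_append_iff successively_Cons conn_empty)
  have "conn (set ps \<union> set qs)"
  proof (cases "ps = [] \<or> qs = []")
    case True
    then show ?thesis using conn_successively suc by auto
  next
    case False
    then obtain ps' p q qs' where pq: "ps = ps' @ [p]" "qs = q # qs'"
      by (metis list.exhaust rev_exhaust)
    have "cyc (p # u # q # qs' @ a # ps')"
      using cyc_rotate[of "a # ps'" "p # u # q # qs'"] ys(1) split pq by simp
    then have "E p q" using ys(2) split pq by (intro chord) auto
    then show ?thesis
      using conn_Un[OF conn_successively[OF suc(1)] conn_successively[OF suc(2)], of p q] pq by simp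
  qed
  moreover have "V - {a} - {u} = set ps \<union> set qs" using V' ys(1) split by (auto simp: cyc_def)
  moreover have "deg (V - {a}) w < deg (V - {a}) u"
    using deg_Diff_singleton[OF fin ab(1), of w] deg_Diff_singleton[OF fin ab(1), of u] reg wu
    by simp
  ultimately have "breakable (V - {a}) u w"
    using wu conn' adj_sym adj_irrefl by (auto simp: breakable_def)
  then show False using unbreakable[of "V - {a}" u w] by blast
qed

lemma brooks_removable:
  assumes "finite V" "V \<noteq> {}" "conn V" and deg_le: "\<forall>v \<in> V. deg V v \<le> d" and "d \<ge> 3"
  shows "(\<forall>u \<in> V. \<forall>v \<in> V. u \<noteq> v \<longrightarrow> E u v) \<or> removable V (\<lambda>_. int (d - 1))"
proof (cases "\<forall>v \<in> V. deg V v = d")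
  case False
  then obtain r where "r \<in> V" "deg V r < d" using deg_le by force
  then have "removable V (\<lambda>_. int (d - 1))"
    using deg_le by (intro removable_if_surplus[OF assms(1,3)]) auto
  then show ?thesis ..
next
  case reg: True
  show ?thesis
  proof (cases "\<exists>H \<subseteq> V. \<exists>u w. breakable H u w")
    case True
    then have "removable V (\<lambda>_. int (d - 1))"
      using removable_if_breakable[OF assms(1,3)] reg \<open>d \<ge> 3\<close> by (auto simp: of_nat_diff)
    then show ?thesis ..
  next
    case False
    have "d \<ge> 1" using \<open>d \<ge> 3\<close> by simp
    from assms(1-3) reg this obtain xs where "cyc xs" "set xs = V"
    proof (cases rule: regular_hamiltonian_or_breakable)
      case breakable
      then show ?thesis using False by blast
    qed
    then have "E u v" if "u \<in> V" "v \<in> V" "u \<noteq> v" for u v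
      using False that by (intro hamiltonian_complete_or_breakable[OF _ _ reg \<open>d \<ge> 3\<close>]) auto
    then show ?thesis by blast
  qed
qed

section \<open>Transfer to graphs\<close>

text \<open>
  The function in a state may take any value outside the remaining vertices, and there the legal steps
  and the game on sets update it differently. The induction therefore asks for agreement on \<open>S\<close> only.
\<close>

lemma removable_imp_legal_steps:
  assumes "removable S f" "verts H = S" "\<forall>v \<in> S. f' v = f v"
    and "\<And>u v. u \<rightarrow>\<^bsub>H\<^esub> v \<longleftrightarrow> u \<in> S \<and> v \<in> S \<and> E u v"
  shows "\<exists>K g. legal_step\<^sup>*\<^sup>* (H, f') (K, g) \<and> verts K = {}"
  using assms
proof (induction arbitrary: H f' rule: removable.induct)
  case (empty f)
  then show ?case by blast
next
  case (del u S g f)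
  let ?H = "pre_digraph.del_vert H u"
  let ?g = "snd (del_op H f' u)"
  have dom: "x \<rightarrow>\<^bsub>?H\<^esub> y \<longleftrightarrow> x \<in> S - {u} \<and> y \<in> S - {u} \<and> E x y" for x y
    using del.prems(3)[of x y]
    by (auto simp: pre_digraph.del_vert_simps arcs_ends_def arc_to_ends_def image_iff)
  have g: "\<forall>v \<in> S - {u}. ?g v = g v"
    using del by (auto simp: del_op_def)
  have "legal_step (H, f') (del_op H f' u)"
    using del.hyps g del.prems by (intro legal_step.del) (auto simp: nonneg_state_def del_op_def pre_digraph.del_vert_simps)
  moreover have "\<exists>K g'. legal_step\<^sup>*\<^sup>* (?H, ?g) (K, g') \<and> verts K = {}"
    using g dom del.prems(1) by (intro del.IH) (auto simp: pre_digraph.del_vert_simps)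
  moreover have "del_op H f' u = (?H, ?g)" by (simp add: del_op_def)
  ultimately show ?case by (metis converse_rtranclp_into_rtranclp)
next
  case (delsave u S w f g)
  let ?H = "pre_digraph.del_vert H u"
  let ?g = "snd (delsave_op H f' u w)"
  have dom: "x \<rightarrow>\<^bsub>?H\<^esub> y \<longleftrightarrow> x \<in> S - {u} \<and> y \<in> S - {u} \<and> E x y" for x y
    using delsave.prems(3)[of x y]
    by (auto simp: pre_digraph.del_vert_simps arcs_ends_def arc_to_ends_def image_iff)
  have g: "\<forall>v \<in> S - {u}. ?g v = g v"
    using delsave by (auto simp: delsave_op_def)
  have "legal_step (H, f') (delsave_op H f' u w)"
    using delsave.hyps g delsave.prems
    by (intro legal_step.delsave) (auto simp: nonneg_state_def delsave_op_def pre_digraph.del_vert_simps)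
  moreover have "\<exists>K g'. legal_step\<^sup>*\<^sup>* (?H, ?g) (K, g') \<and> verts K = {}"
    using g dom delsave.prems(1) by (intro delsave.IH) (auto simp: pre_digraph.del_vert_simps)
  moreover have "delsave_op H f' u w = (?H, ?g)" by (simp add: delsave_op_def)
  ultimately show ?case by (metis converse_rtranclp_into_rtranclp)
qed

end

lemma (in graph) adjacency_dominates: "adjacency (\<lambda>u v. u \<rightarrow>\<^bsub>G\<^esub> v)"
proof
  show "v \<rightarrow>\<^bsub>G\<^esub> u" if "u \<rightarrow>\<^bsub>G\<^esub> v" for u v
    using that sym_arcs by (auto simp: symmetric_def dest: symD)
  show "\<not> v \<rightarrow>\<^bsub>G\<^esub> v" for v using no_loops by (fastforce simp: arcs_ends_def arc_to_ends_def)
qed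

text \<open>
  Without parallel arcs, an arc out of \<open>v\<close> is determined by its head.
\<close>

lemma (in graph) out_degree_eq_card_neighbours: "out_degree G v = card {w \<in> verts G. v \<rightarrow>\<^bsub>G\<^esub> w}"
proof -
  have "bij_betw (head G) (out_arcs G v) {w \<in> verts G. v \<rightarrow>\<^bsub>G\<^esub> w}"
    unfolding bij_betw_def
  proof
    show "inj_on (head G) (out_arcs G v)"
      using no_multi_arcs by (intro inj_onI) (auto simp: arc_to_ends_def)
    show "head G ` out_arcs G v = {w \<in> verts G. v \<rightarrow>\<^bsub>G\<^esub> w}"
      by (auto simp: arcs_ends_def arc_to_ends_def image_iff)
  qed
  then show ?thesis unfolding out_degree_def by (rule bij_betw_same_card)
qed

lemma (in graph) conn_verts:
  assumes "Digraph_Component.connected G"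
  shows "adjacency.conn (\<lambda>u v. u \<rightarrow>\<^bsub>G\<^esub> v) (verts G)"
proof -
  interpret adjacency "\<lambda>u v. u \<rightarrow>\<^bsub>G\<^esub> v" by (rule adjacency_dominates)
  show ?thesis
    unfolding conn_def
  proof (intro allI impI, rule ccontr)
    fix A assume A: "A \<subseteq> verts G" "A \<noteq> {}" "A \<noteq> verts G"
      and closed: "\<not> (\<exists>x \<in> A. \<exists>y \<in> verts G - A. x \<rightarrow>\<^bsub>G\<^esub> y)"
    obtain x y where xy: "x \<in> A" "y \<in> verts G" "y \<notin> A" using A by blast
    have "x \<rightarrow>\<^sup>*\<^bsub>mk_symmetric G\<^esub> y"
      using assms xy A by (auto simp: connected_def strongly_connected_def)
    then have "x \<rightarrow>\<^sup>* y" using reachable_mk_symmetric_eq sym_arcs by simp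
    then have "y \<in> A"
      unfolding reachable_def
      by (induction rule: rtrancl_on_induct) (use xy closed in auto)
    then show False using xy by simp
  qed
qed

lemma (in graph) complete_imp_iso:
  assumes "card (verts G) = n"
    and "\<And>u v. u \<in> verts G \<Longrightarrow> v \<in> verts G \<Longrightarrow> u \<noteq> v \<Longrightarrow> u \<rightarrow>\<^bsub>G\<^esub> v"
  shows "digraph_iso G (with_proj (complete_graph n))"
proof -
  obtain h where h: "bij_betw h (verts G) {..<n}"
    using assms(1) finite_verts by (metis atLeast0LessThan ex_bij_betw_finite_nat)
  define F where "F = \<lparr> iso_verts = h, iso_arcs = (\<lambda>e. (h (tail G e), h (head G e))),
    iso_head = snd, iso_tail = fst \<rparr>"
  have inj: "inj_on h (verts G)" and img: "h ` verts G = {..<n}" using h by (auto simp: bij_betw_def)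
  have "inj_on (iso_arcs F) (arcs G)"
    using inj no_multi_arcs by (intro inj_onI) (auto simp: F_def arc_to_ends_def inj_on_eq_iff)
  then have "digraph_isomorphism F"
    using inj wf_digraph by (simp add: digraph_isomorphism_def F_def)
  moreover have "iso_arcs F ` arcs G = {(i, j). i < n \<and> j < n \<and> i \<noteq> j}"
  proof (intro set_eqI iffI)
    fix p assume "p \<in> iso_arcs F ` arcs G"
    then obtain e where "e \<in> arcs G" "p = (h (tail G e), h (head G e))" by (auto simp: F_def)
    then show "p \<in> {(i, j). i < n \<and> j < n \<and> i \<noteq> j}"
      using img inj no_loops[of e] by (auto simp: inj_on_eq_iff)
  next
    fix p assume "p \<in> {(i, j). i < n \<and> j < n \<and> i \<noteq> j}"
    then obtain i j where "p = (i, j)" "i \<in> h ` verts G" "j \<in> h ` verts G" "i \<noteq> j"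
      using img by auto
    then obtain u v where uv: "u \<in> verts G" "v \<in> verts G" "u \<noteq> v" "p = (h u, h v)" by auto
    then have "u \<rightarrow>\<^bsub>G\<^esub> v" using assms(2) by blast
    then obtain e where "e \<in> arcs G" "tail G e = u" "head G e = v"
      by (auto simp: arcs_ends_def arc_to_ends_def)
    then show "p \<in> iso_arcs F ` arcs G" using uv by (auto simp: F_def)
  qed
  then have "app_iso F G = with_proj (complete_graph n)"
    using img by (auto simp: app_iso_def F_def complete_graph_def with_proj_def)
  ultimately show ?thesis unfolding digraph_iso_def by metis
qed

theorem theorem1p5:
  fixes G :: "('a, 'b) pre_digraph" and d :: nat
  assumes "graph G"
    and "Digraph_Component.connected G"
    and "max_degree G = d"
    and "d \<ge> 3"
  shows "digraph_iso G (with_proj (complete_graph (d + 1))) \<or> weakly_degenerate (d - 1) G"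
proof -
  interpret graph G by fact
  interpret adjacency "\<lambda>u v. u \<rightarrow>\<^bsub>G\<^esub> v" by (rule adjacency_dominates)
  let ?V = "verts G"
  have ne: "?V \<noteq> {}" using assms(2) by (auto simp: connected_def strongly_connected_def)
  have deg_eq: "deg ?V v = out_degree G v" for v
    by (simp add: deg_def out_degree_eq_card_neighbours)
  have fin: "finite (out_degree G ` ?V)" by simp
  have deg_le: "\<forall>v \<in> ?V. deg ?V v \<le> d"
    using assms(3) fin by (auto simp: deg_eq max_degree_def)
  have "d \<in> out_degree G ` ?V" using assms(3) Max_in[OF fin] ne by (auto simp: max_degree_def)
  then obtain m where m: "m \<in> ?V" "deg ?V m = d" by (auto simp: deg_eq)
  consider "\<forall>u \<in> ?V. \<forall>v \<in> ?V. u \<noteq> v \<longrightarrow> u \<rightarrow>\<^bsub>G\<^esub> v" | "removable ?V (\<lambda>_. int (d - 1))"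
    using brooks_removable[OF finite_verts ne conn_verts[OF assms(2)] deg_le assms(4)] by blast
  then show ?thesis
  proof cases
    case 1
    then have "{w \<in> ?V. m \<rightarrow>\<^bsub>G\<^esub> w} = ?V - {m}" using m adj_irrefl by auto
    then have "card (?V - {m}) = d" using m by (simp add: deg_def)
    then have "card ?V = d + 1" using m(1) assms(4) by simp
    then show ?thesis using complete_imp_iso 1 by blast
  next
    case 2
    have "\<exists>K g. legal_step\<^sup>*\<^sup>* (G, \<lambda>_. int (d - 1)) (K, g) \<and> verts K = {}"
      using removable_imp_legal_steps[OF 2 refl, of "\<lambda>_. int (d - 1)"] adj_in_verts by blast
    then show ?thesis by (simp add: weakly_degenerate_def weakly_f_degenerate_def)
  qed
qed

end
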